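(* Let $f,g:X\to Y$ be homotopic continuous maps and let $B\subseteq X$. Then $TC^S(f,B)=TC^S(g,B)$.
   Context: For a topological space $Y$, $PY=Y^I$ is the space of continuous paths $[0,1]\to Y$ with the compact-open topology, and for $C\subseteq Y$, $P_{Y\times C}=\{\gamma\in PY:\gamma(1)\in C\}$. For a continuous map $f:X\to Y$ and $B\subseteq X$, $TC^S(f,B)$ is the least integer $n\ge0$ such that $X\times B$ has an open cover $U_0,\dots,U_n$ with, for each $i$, a continuous map $\sigma_i:U_i\to P_{Y\times f(B)}$ satisfying $\sigma_i(x,b)(0)=f(x)$ and $\sigma_i(x,b)(1)=f(b)$; it is $\infty$ if there is no such cover. *)

theory Defs
  imports "HOL-Analysis.Analysis"
begin

text \<open>Topological spaces are rendered as \<^typ>\<open>'a topology\<close>. Continuous maps form a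
  space of functions only after fixing their values off the domain; we use the
  extensional representatives. The choice \<open>K = {}\<close> makes the whole set of continuous maps
  a subbasic set.\<close>

definition cmaps :: "'a topology \<Rightarrow> 'b topology \<Rightarrow> ('a \<Rightarrow> 'b) set" where
  "cmaps X Y = {f \<in> extensional (topspace X). continuous_map X Y f}"

definition compact_open_topology ::
    "'a topology \<Rightarrow> 'b topology \<Rightarrow> ('a \<Rightarrow> 'b) topology" where
  "compact_open_topology X Y =
     topology_generated_by {{f \<in> cmaps X Y. f ` K \<subseteq> V} | K V. compactin X K \<and> openin Y V}"

lemma topspace_compact_open_topology [simp]:
  "topspace (compact_open_topology X Y) = cmaps X Y"
proof -
  have "cmaps X Y = {f \<in> cmaps X Y. f ` {} \<subseteq> {}} \<and> compactin X {} \<and> openin Y {}"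
    by auto
  then have "cmaps X Y \<in> {{f \<in> cmaps X Y. f ` K \<subseteq> V} | K V. compactin X K \<and> openin Y V}"
    by blast
  then show ?thesis
    unfolding compact_open_topology_def by (auto simp: topology_generated_by_topspace)
qed

definition path_space :: "'b topology \<Rightarrow> (real \<Rightarrow> 'b) topology" where
  "path_space Y = compact_open_topology (top_of_set {0..1}) Y"

text \<open>The subspace \<open>P\<^bsub>Y\<times>C\<^esub>\<close> of paths ending in \<open>C\<close>.\<close>

definition path_space_ending :: "'b topology \<Rightarrow> 'b set \<Rightarrow> (real \<Rightarrow> 'b) topology" where
  "path_space_ending Y C =
     subtopology (path_space Y) {\<gamma> \<in> topspace (path_space Y). \<gamma> 1 \<in> C}"

definition TCS_cover ::
    "'a topology \<Rightarrow> 'b topology \<Rightarrow> ('a \<Rightarrow> 'b) \<Rightarrow> 'a set \<Rightarrow> nat \<Rightarrow> bool" where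
  "TCS_cover X Y f B n \<longleftrightarrow>
     (\<exists>U :: nat \<Rightarrow> ('a \<times> 'a) set.
        (\<forall>i\<le>n. openin (prod_topology X (subtopology X B)) (U i)) \<and>
        (\<Union>i\<le>n. U i) = topspace X \<times> B \<and>
        (\<forall>i\<le>n. \<exists>\<sigma> :: 'a \<times> 'a \<Rightarrow> real \<Rightarrow> 'b.
           continuous_map (subtopology (prod_topology X (subtopology X B)) (U i))
             (path_space_ending Y (f ` B)) \<sigma> \<and>
           (\<forall>(x, b) \<in> U i. \<sigma> (x, b) 0 = f x \<and> \<sigma> (x, b) 1 = f b)))"

text \<open>The infimum of the empty set in \<^typ>\<open>enat\<close> is \<open>\<infinity>\<close>. The definition is meant for
  \<open>f\<close> continuous and \<open>B \<subseteq> topspace X\<close>.\<close>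

definition TCS :: "'a topology \<Rightarrow> 'b topology \<Rightarrow> ('a \<Rightarrow> 'b) \<Rightarrow> 'a set \<Rightarrow> enat" where
  "TCS X Y f B = Inf {enat n | n. TCS_cover X Y f B n}"

end

theory Submission
  imports Defs
begin

text \<open>Fix a homotopy \<open>h\<close> from \<open>f\<close> to \<open>g\<close>. If \<open>\<gamma>\<close> is a path from \<open>f x\<close> to \<open>f b\<close>, then running
  \<open>h(-, x)\<close> backwards, then \<open>\<gamma>\<close>, then \<open>h(-, b)\<close> forwards gives a path from \<open>g x\<close> to \<open>g b\<close>. Doing
  this for every \<open>(x, b)\<close> in a member of a cover turns a motion planner for \<open>f\<close> into one for
  \<open>g\<close> over the same open set, so every cover that works for \<open>f\<close> works for \<open>g\<close>
  (\<open>TCS_cover_homotopic\<close>); homotopy being symmetric, the two invariants agree.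

  Only the continuity of the new planner in the compact-open topology needs an argument. It is
  checked on the adjoint maps \<open>Z \<times> [0,1] \<rightarrow> Y\<close>, where concatenation is a matter of pasting along
  a closed set. The passage back and forth is the exponential law: uncurrying is continuous
  because \<open>[0,1]\<close> has a base of compact neighbourhoods (\<open>continuous_map_uncurry_compact_open\<close>), and
  currying is continuous for every parameter space by the tube lemma
  (\<open>continuous_map_curry_compact_open\<close>).\<close>

text \<open>A value \<open>\<sigma> z t\<close> in an open set \<open>V\<close> stays in \<open>V\<close> on a compact neighbourhood \<open>K\<close> of \<open>t\<close>; the
  functions that map \<open>K\<close> into \<open>V\<close> form an open set, so the same \<open>K\<close> serves all parameters
  near \<open>z\<close>.\<close>

lemma continuous_map_uncurry_compact_open:
  assumes base: "neighbourhood_base_of (compactin X) X"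
    and \<sigma>: "continuous_map Z (compact_open_topology X Y) \<sigma>"
  shows "continuous_map (prod_topology Z X) Y (\<lambda>(z, t). \<sigma> z t)"
proof -
  have \<sigma>z: "continuous_map X Y (\<sigma> z)" if "z \<in> topspace Z" for z
    using continuous_map_image_subset_topspace[OF \<sigma>] that by (auto simp: cmaps_def)
  have "openin (prod_topology Z X) {p \<in> topspace (prod_topology Z X). (case p of (z, t) \<Rightarrow> \<sigma> z t) \<in> V}"
    (is "openin _ ?W") if V: "openin Y V" for V
    unfolding openin_prod_topology_alt
  proof (intro allI impI)
    fix z t assume "(z, t) \<in> ?W"
    then have zt: "z \<in> topspace Z" "t \<in> topspace X" "\<sigma> z t \<in> V" by auto
    have "openin X {s \<in> topspace X. \<sigma> z s \<in> V}"
      using \<sigma>z[OF zt(1)] V by (rule openin_continuous_map_preimage)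
    with base zt obtain T K where TK: "openin X T" "compactin X K" "t \<in> T" "T \<subseteq> K"
        "K \<subseteq> {s \<in> topspace X. \<sigma> z s \<in> V}"
      unfolding neighbourhood_base_of by (metis (no_types, lifting) mem_Collect_eq)
    have "openin (compact_open_topology X Y) {f \<in> cmaps X Y. f ` K \<subseteq> V}"
      unfolding compact_open_topology_def
      using TK V by (intro topology_generated_by_Basis) blast
    then have "openin Z {y \<in> topspace Z. \<sigma> y \<in> {f \<in> cmaps X Y. f ` K \<subseteq> V}}" (is "openin Z ?S")
      using \<sigma> by (rule openin_continuous_map_preimage[rotated])
    moreover have "\<sigma> z \<in> cmaps X Y"
      using continuous_map_image_subset_topspace[OF \<sigma>] zt by auto
    then have "z \<in> ?S" using zt TK by auto
    moreover have "?S \<times> T \<subseteq> ?W"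
      using \<open>T \<subseteq> K\<close> openin_subset[OF TK(1)] by (auto simp: image_subset_iff subset_iff)
    ultimately show "\<exists>S T. openin Z S \<and> openin X T \<and> z \<in> S \<and> t \<in> T \<and> S \<times> T \<subseteq> ?W"
      using TK by blast
  qed
  moreover have "\<sigma> z t \<in> topspace Y" if "z \<in> topspace Z" "t \<in> topspace X" for z t
    using continuous_map_image_subset_topspace[OF \<sigma>z[OF that(1)]] that by auto
  ultimately show ?thesis
    unfolding continuous_map by auto
qed

text \<open>The restriction makes the curried values extensional, as the elements of \<^const>\<open>cmaps\<close> are.
  If \<open>F\<close> maps \<open>{z} \<times> K\<close> into an open set and \<open>K\<close> is compact, then it does so on a tube around
  \<open>{z} \<times> K\<close>.\<close>

lemma continuous_map_curry_compact_open:
  assumes F: "continuous_map (prod_topology Z X) Y F"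
  shows "continuous_map Z (compact_open_topology X Y) (\<lambda>z. \<lambda>t\<in>topspace X. F (z, t))"
    (is "continuous_map Z _ ?c")
proof -
  have c: "?c z \<in> cmaps X Y" if "z \<in> topspace Z" for z
  proof -
    have "continuous_map X Y (F \<circ> (\<lambda>t. (z, t)))"
      using that by (intro continuous_map_compose[OF _ F] continuous_map_pairedI) auto
    then have "continuous_map X Y (?c z)"
      by (rule continuous_map_eq) auto
    then show ?thesis by (auto simp: cmaps_def)
  qed
  have open_pre: "openin Z {z \<in> topspace Z. ?c z ` K \<subseteq> V}" (is "openin Z ?S")
    if K: "compactin X K" and V: "openin Y V" for K V
  proof (subst openin_subopen, intro ballI)
    fix z assume z: "z \<in> ?S"
    have KX: "K \<subseteq> topspace X" using K by (rule compactin_subset_topspace)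
    let ?W = "{p \<in> topspace (prod_topology Z X). F p \<in> V}"
    have W: "openin (prod_topology Z X) ?W"
      using F V by (rule openin_continuous_map_preimage)
    have "compactin Z {z}" using z by simp
    moreover have "{z} \<times> K \<subseteq> ?W" using z KX by (auto simp: image_subset_iff subset_iff)
    ultimately obtain S T where ST: "openin Z S" "openin X T" "{z} \<subseteq> S" "K \<subseteq> T" "S \<times> T \<subseteq> ?W"
      using Wallace_theorem_prod_topology[OF _ K W] by blast
    have "S \<subseteq> ?S"
      using ST KX openin_subset[OF ST(1)] by (auto simp: image_subset_iff subset_iff)
    with ST show "\<exists>T. openin Z T \<and> z \<in> T \<and> T \<subseteq> ?S" by auto
  qed
  show ?thesis
    unfolding compact_open_topology_def
  proof (rule continuous_on_generated_topo)
    fix U assume "U \<in> {{f \<in> cmaps X Y. f ` K \<subseteq> V} | K V. compactin X K \<and> openin Y V}"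
    then obtain K V where KV: "U = {f \<in> cmaps X Y. f ` K \<subseteq> V}" "compactin X K" "openin Y V"
      by blast
    have "?c -` U \<inter> topspace Z = {z \<in> topspace Z. ?c z ` K \<subseteq> V}"
      using c KV(1) by auto
    then show "openin Z (?c -` U \<inter> topspace Z)" using open_pre KV by simp
  next
    have "topspace (compact_open_topology X Y) =
        \<Union>{{f \<in> cmaps X Y. f ` K \<subseteq> V} | K V. compactin X K \<and> openin Y V}"
      unfolding compact_open_topology_def by (rule topology_generated_by_topspace)
    then show "?c ` topspace Z \<subseteq> \<Union>{{f \<in> cmaps X Y. f ` K \<subseteq> V} | K V. compactin X K \<and> openin Y V}"
      using c by auto
  qed
qed

lemma neighbourhood_base_of_compactin_unit_interval:
  "neighbourhood_base_of (compactin (top_of_set {0..1::real})) (top_of_set {0..1})"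
proof -
  have "locally_compact_space (top_of_set {0..1::real})"
    by (intro compact_imp_locally_compact_space) (simp add: compact_space_subtopology)
  then show ?thesis
    by (meson Hausdorff_space_euclidean Hausdorff_space_subtopology
        locally_compact_space_neighbourhood_base)
qed

definition concat_paths :: "(real \<Rightarrow> 'b) \<Rightarrow> (real \<Rightarrow> 'b) \<Rightarrow> real \<Rightarrow> 'b" where
  "concat_paths p q t = (if t \<le> 1/2 then p (2 * t) else q (2 * t - 1))"

lemma concat_paths_0 [simp]: "concat_paths p q 0 = p 0"
  and concat_paths_1 [simp]: "concat_paths p q 1 = q 1"
  by (simp_all add: concat_paths_def)

lemma continuous_map_concat_paths:
  assumes p: "continuous_map (prod_topology Z (top_of_set {0..1})) Y (\<lambda>(z, t). p z t)"
    and q: "continuous_map (prod_topology Z (top_of_set {0..1})) Y (\<lambda>(z, t). q z t)"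
    and match: "\<And>z. z \<in> topspace Z \<Longrightarrow> p z 1 = q z 0"
  shows "continuous_map (prod_topology Z (top_of_set {0..1})) Y
           (\<lambda>(z, t). concat_paths (p z) (q z) t)"
proof -
  let ?I = "top_of_set {0..1::real}"
  let ?ZI = "prod_topology Z ?I"
  have snd: "continuous_map ?ZI euclideanreal snd"
    using continuous_map_snd[of Z ?I] by (simp only: continuous_map_in_subtopology)
  \<comment> \<open>The set \<open>S\<close> stands for the first or the second half of the time interval; the affine
    change of time need not keep the other half inside the domain of the path.\<close>
  have reparam: "continuous_map (subtopology ?ZI S) Y (\<lambda>w. r (fst w) (a * snd w - c))"
    if r: "continuous_map ?ZI Y (\<lambda>(z, t). r z t)"
      and S: "\<And>w. w \<in> topspace ?ZI \<Longrightarrow> w \<in> S \<Longrightarrow> a * snd w - c \<in> {0..1}"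
    for r :: "'a \<Rightarrow> real \<Rightarrow> 'b" and a c :: real and S
  proof -
    have "continuous_map (subtopology ?ZI S) ?I (\<lambda>w. a * snd w - c)"
      using S by (intro continuous_map_into_subtopology continuous_intros
          continuous_map_from_subtopology[OF snd]) auto
    then have "continuous_map (subtopology ?ZI S) Y
        ((\<lambda>(z, t). r z t) \<circ> (\<lambda>w. (fst w, a * snd w - c)))"
      by (intro continuous_map_compose[OF _ r] continuous_map_pairedI
          continuous_map_from_subtopology[OF continuous_map_fst])
    then show ?thesis by (simp add: o_def)
  qed
  have "continuous_map ?ZI Y
      (\<lambda>w. if snd w \<le> 1/2 then p (fst w) (2 * snd w - 0) else q (fst w) (2 * snd w - 1))"
    by (rule continuous_map_cases_le[OF snd _ reparam[OF p] reparam[OF q]])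
       (auto simp: match mult.commute)
  then show ?thesis by (simp add: concat_paths_def case_prod_unfold cong: if_cong)
qed

text \<open>The end \<open>g b\<close> of the prolonged path lies in \<open>g ` B\<close>, so the new planner again has values
  in the required subspace of the path space.\<close>

lemma TCS_cover_homotopic:
  assumes hom: "homotopic_with (\<lambda>_. True) X Y f g"
    and cover: "TCS_cover X Y f B n"
  shows "TCS_cover X Y g B n"
proof -
  let ?I = "top_of_set {0..1::real}"
  obtain h where h: "continuous_map (prod_topology ?I X) Y h"
      and h0: "\<And>x. h (0, x) = f x" and h1: "\<And>x. h (1, x) = g x"
    using hom unfolding homotopic_with_def by auto
  obtain U where U: "\<And>i. i \<le> n \<Longrightarrow> openin (prod_topology X (subtopology X B)) (U i)"
      and UN: "(\<Union>i\<le>n. U i) = topspace X \<times> B"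
      and planner: "\<And>i. i \<le> n \<Longrightarrow> \<exists>\<sigma>.
           continuous_map (subtopology (prod_topology X (subtopology X B)) (U i))
             (path_space_ending Y (f ` B)) \<sigma> \<and>
           (\<forall>(x, b) \<in> U i. \<sigma> (x, b) 0 = f x \<and> \<sigma> (x, b) 1 = f b)"
    using cover unfolding TCS_cover_def by blast
  have "\<exists>\<tau>. continuous_map (subtopology (prod_topology X (subtopology X B)) (U i))
             (path_space_ending Y (g ` B)) \<tau> \<and>
           (\<forall>(x, b) \<in> U i. \<tau> (x, b) 0 = g x \<and> \<tau> (x, b) 1 = g b)"
    if i: "i \<le> n" for i
  proof -
    let ?Z = "subtopology (prod_topology X (subtopology X B)) (U i)"
    obtain \<sigma> where \<sigma>: "continuous_map ?Z (path_space_ending Y (f ` B)) \<sigma>"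
        and ends: "\<And>x b. (x, b) \<in> U i \<Longrightarrow> \<sigma> (x, b) 0 = f x \<and> \<sigma> (x, b) 1 = f b"
      using planner[OF i] by blast
    have ZU: "topspace ?Z = U i"
      using openin_subset[OF U[OF i]] by auto
    have fst: "continuous_map (prod_topology ?Z ?I) X (\<lambda>w. fst (fst w))"
      using continuous_map_compose[OF continuous_map_fst
          continuous_map_from_subtopology[OF continuous_map_fst]]
      by (simp add: o_def)
    have "continuous_map (prod_topology X (subtopology X B)) X snd"
      using continuous_map_snd[of X "subtopology X B"] by (simp only: continuous_map_in_subtopology)
    then have snd: "continuous_map (prod_topology ?Z ?I) X (\<lambda>w. snd (fst w))"
      using continuous_map_compose[OF continuous_map_fst continuous_map_from_subtopology]
      by (simp add: o_def)
    have time: "continuous_map (prod_topology ?Z ?I) ?I snd"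
      by (rule continuous_map_snd)
    then have time_real: "continuous_map (prod_topology ?Z ?I) euclideanreal snd"
      by (simp only: continuous_map_in_subtopology)
    have time_rev: "continuous_map (prod_topology ?Z ?I) ?I (\<lambda>w. 1 - snd w)"
      by (intro continuous_map_into_subtopology continuous_intros time_real) auto
    have start: "continuous_map (prod_topology ?Z ?I) Y (\<lambda>(z, t). h (1 - t, fst z))"
      using continuous_map_compose[OF continuous_map_pairedI[OF time_rev fst] h]
      by (simp add: o_def case_prod_unfold)
    have finish: "continuous_map (prod_topology ?Z ?I) Y (\<lambda>(z, t). h (t, snd z))"
      using continuous_map_compose[OF continuous_map_pairedI[OF time snd] h]
      by (simp add: o_def case_prod_unfold)
    have "continuous_map ?Z (compact_open_topology ?I Y) \<sigma>"
      using \<sigma> by (simp add: path_space_ending_def path_space_def continuous_map_in_subtopology)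
    then have middle: "continuous_map (prod_topology ?Z ?I) Y (\<lambda>(z, t). \<sigma> z t)"
      by (rule continuous_map_uncurry_compact_open[OF neighbourhood_base_of_compactin_unit_interval])
    define F where "F = (\<lambda>z. concat_paths (\<lambda>t. h (1 - t, fst z))
                                (concat_paths (\<sigma> z) (\<lambda>t. h (t, snd z))))"
    have F: "continuous_map (prod_topology ?Z ?I) Y (\<lambda>(z, t). F z t)"
      unfolding F_def using ends ZU
      by (intro continuous_map_concat_paths start middle finish) (auto simp: h0)
    define \<tau> where "\<tau> = (\<lambda>z. \<lambda>t\<in>topspace ?I. F z t)"
    have \<tau>_ends: "\<tau> (x, b) 0 = g x \<and> \<tau> (x, b) 1 = g b" for x b
      by (simp add: \<tau>_def F_def h1)
    have "U i \<subseteq> topspace X \<times> B" using UN i by blast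
    moreover have \<tau>: "continuous_map ?Z (path_space Y) \<tau>"
      unfolding \<tau>_def path_space_def
      using continuous_map_curry_compact_open[OF F] by (simp only: prod.case)
    ultimately have "continuous_map ?Z (path_space_ending Y (g ` B)) \<tau>"
      unfolding path_space_ending_def
      using continuous_map_image_subset_topspace[OF \<tau>] \<tau>_ends ZU
      by (intro continuous_map_into_subtopology) fastforce+
    with \<tau>_ends show ?thesis by auto
  qed
  with U UN show ?thesis unfolding TCS_cover_def by blast
qed

theorem proposition5p3:
  fixes X :: "'a topology" and Y :: "'b topology"
    and f g :: "'a \<Rightarrow> 'b" and B :: "'a set"
  assumes "continuous_map X Y f" and "continuous_map X Y g"
    and "homotopic_with (\<lambda>_. True) X Y f g"
    and "B \<subseteq> topspace X"
  shows "TCS X Y f B = TCS X Y g B"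
proof -
  have "TCS_cover X Y f B n \<longleftrightarrow> TCS_cover X Y g B n" for n
    using assms(3) TCS_cover_homotopic homotopic_with_symD by metis
  then show ?thesis by (simp add: TCS_def)
qed

end
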